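(* Let $G$ be a connected undirected weighted graph on the vertices $\{1,\ldots,n\}$ with symmetric nonnegative adjacency matrix $A=(a_{ij})$, $n\ge 2$. Let $1\le p<q\le n$ be such that $a_{pq}\neq0$ and the edge $\{p,q\}$ is not a cut-edge. With $S$, $\bm w_{pq}$, $c(p,q)$ and $\mu(p,q)$ as in the context, $$c(p,q)=\frac{\mu(p,q)}{1-a_{pq}\,\bm w_{pq}^\top S^{-1}\bm w_{pq}}.$$
   Context: $G$ is a connected undirected weighted graph on $\{1,\ldots,n\}$ (loops allowed) with symmetric adjacency matrix $A=(a_{ij})$: $a_{ij}=a_{ji}>0$ is the weight of the edge $\{i,j\}$ if it exists, and $a_{ij}=0$ otherwise. A cut-edge is an edge whose removal disconnects the graph. Let $\bm 1$ be the all-ones vector, $\bm e_i$ the $i$-th standard basis vector, $\bm d=A\bm 1=(d_i)$ (all $d_i>0$ by connectedness), $D=\mathrm{diag}(\bm d)$, $P=D^{-1}A$ (an irreducible stochastic matrix), $S=D-A+\frac{1}{\|\bm d\|_1}\bm d\bm d^\top$ (which is symmetric positive definite), and $\bm w_{pq}=\bm e_p-\bm e_q$. Kemeny's constant: for a real $n\times n$ matrix $Q$ with $Q\bm 1=\bm 1$, put $\kappa(Q)=\mathrm{trace}\big((I-Q+\bm 1\bm v^\top)^{-1}\big)-1$, where $\bm v\in\mathbb R^n$ is any vector with $\bm v^\top\bm 1=1$; it is defined whenever the inverse exists and does not depend on $\bm v$. For the matrices considered here one may take $\bm v=\bm d/\|\bm d\|_1$. For an edge $\{p,q\}$ that is not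 a cut-edge, the Kemeny-based centrality is $c(p,q)=\kappa(P_{pq})-\kappa(P)$, where $P_{pq}=D^{-1}(A+a_{pq}\bm w_{pq}\bm w_{pq}^\top)$ is the transition matrix of the graph obtained from $G$ by removing the edge $\{p,q\}$ and adding weight $a_{pq}$ to the loops at $p$ and at $q$. The weighted derivative-based centrality is $$\mu(p,q)=\lim_{t\to0^+}\frac{\kappa(P+t\,a_{pq}D^{-1}\bm w_{pq}\bm w_{pq}^\top)-\kappa(P)}{t}.$$ *)

theory Defs
  imports "HOL-Analysis.Analysis"
begin

definition outer :: "real ^ 'n \<Rightarrow> real ^ 'n \<Rightarrow> real ^ 'n ^ 'n" where
  "outer u v = (\<chi> i j. u $ i * v $ j)"

definition diag_mat :: "real ^ 'n \<Rightarrow> real ^ 'n ^ 'n" where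
  "diag_mat d = (\<chi> i j. if i = j then d $ i else 0)"

definition l1_norm :: "real ^ 'n \<Rightarrow> real" where
  "l1_norm x = (\<Sum>i\<in>UNIV. \<bar>x $ i\<bar>)"

text \<open>
  An undirected weighted graph on the finite vertex type is given by its adjacency matrix;
  \<open>{i, j}\<close> is an edge iff the entry is nonzero. Diagonal entries are weights of loops.
\<close>

definition weighted_graph :: "real ^ 'n ^ 'n \<Rightarrow> bool" where
  "weighted_graph A \<longleftrightarrow> transpose A = A \<and> (\<forall>i j. 0 \<le> A $ i $ j)"

definition graph_connected :: "real ^ 'n ^ 'n \<Rightarrow> bool" where
  "graph_connected A \<longleftrightarrow> (\<forall>i j. (\<lambda>k l. A $ k $ l \<noteq> 0)\<^sup>*\<^sup>* i j)"

definition remove_edge :: "'n \<Rightarrow> 'n \<Rightarrow> real ^ 'n ^ 'n \<Rightarrow> real ^ 'n ^ 'n" where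
  "remove_edge p q A = (\<chi> i j. if {i, j} = {p, q} then 0 else A $ i $ j)"

definition cut_edge :: "real ^ 'n ^ 'n \<Rightarrow> 'n \<Rightarrow> 'n \<Rightarrow> bool" where
  "cut_edge A p q \<longleftrightarrow> A $ p $ q \<noteq> 0 \<and> \<not> graph_connected (remove_edge p q A)"

definition degree_vec :: "real ^ 'n ^ 'n \<Rightarrow> real ^ 'n" where
  "degree_vec A = A *v vec 1"

definition degree_mat :: "real ^ 'n ^ 'n \<Rightarrow> real ^ 'n ^ 'n" where
  "degree_mat A = diag_mat (degree_vec A)"

definition transition_mat :: "real ^ 'n ^ 'n \<Rightarrow> real ^ 'n ^ 'n" where
  "transition_mat A = matrix_inv (degree_mat A) ** A"

definition S_mat :: "real ^ 'n ^ 'n \<Rightarrow> real ^ 'n ^ 'n" where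
  "S_mat A = degree_mat A - A
     + (1 / l1_norm (degree_vec A)) *\<^sub>R outer (degree_vec A) (degree_vec A)"

definition edge_vec :: "'n \<Rightarrow> 'n \<Rightarrow> real ^ 'n" where
  "edge_vec p q = axis p 1 - axis q 1"

text \<open>
  \<open>has_kemeny Q k\<close>: some admissible vector \<open>v\<close> makes the matrix below invertible and yields the
  value \<open>k\<close>. Kemeny's constant of \<open>Q\<close> is defined if there is exactly one such value, i.e. the
  inverse exists for some \<open>v\<close> and the value is independent of the choice of \<open>v\<close>.
\<close>

definition has_kemeny :: "real ^ 'n ^ 'n \<Rightarrow> real \<Rightarrow> bool" where
  "has_kemeny Q k \<longleftrightarrow> Q *v vec 1 = vec 1 \<and>
     (\<exists>v. v \<bullet> vec 1 = 1 \<and> invertible (mat 1 - Q + outer (vec 1) v) \<and>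
          k = trace (matrix_inv (mat 1 - Q + outer (vec 1) v)) - 1)"

definition kemeny_defined :: "real ^ 'n ^ 'n \<Rightarrow> bool" where
  "kemeny_defined Q \<longleftrightarrow> (\<exists>!k. has_kemeny Q k)"

definition kemeny :: "real ^ 'n ^ 'n \<Rightarrow> real" where
  "kemeny Q = (THE k. has_kemeny Q k)"

text \<open>
  Removing the edge \<open>{p, q}\<close> while adding its weight to the loops at \<open>p\<close> and \<open>q\<close> leaves all
  degrees unchanged, so the degree matrix is that of the original graph.
\<close>

definition removed_transition_mat :: "real ^ 'n ^ 'n \<Rightarrow> 'n \<Rightarrow> 'n \<Rightarrow> real ^ 'n ^ 'n" where
  "removed_transition_mat A p q =
     matrix_inv (degree_mat A) ** (A + (A $ p $ q) *\<^sub>R outer (edge_vec p q) (edge_vec p q))"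

definition kemeny_centrality :: "real ^ 'n ^ 'n \<Rightarrow> 'n \<Rightarrow> 'n \<Rightarrow> real" where
  "kemeny_centrality A p q = kemeny (removed_transition_mat A p q) - kemeny (transition_mat A)"

definition perturbed_mat :: "real ^ 'n ^ 'n \<Rightarrow> 'n \<Rightarrow> 'n \<Rightarrow> real \<Rightarrow> real ^ 'n ^ 'n" where
  "perturbed_mat A p q t = transition_mat A
     + (t * A $ p $ q) *\<^sub>R (matrix_inv (degree_mat A) ** outer (edge_vec p q) (edge_vec p q))"

definition kemeny_quotient :: "real ^ 'n ^ 'n \<Rightarrow> 'n \<Rightarrow> 'n \<Rightarrow> real \<Rightarrow> real" where
  "kemeny_quotient A p q t = (kemeny (perturbed_mat A p q t) - kemeny (transition_mat A)) / t"

definition derivative_centrality :: "real ^ 'n ^ 'n \<Rightarrow> 'n \<Rightarrow> 'n \<Rightarrow> real" where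
  "derivative_centrality A p q = Lim (at_right 0) (kemeny_quotient A p q)"

end

theory Submission
  imports Defs
begin

text \<open>
  Put \<open>v = d / |d|\<^sub>1\<close>, \<open>a\<close> the weight of the edge and
  \<open>Q\<^sub>t = P + t a D\<^sup>-\<^sup>1 w w\<^sup>T\<close>. Then \<open>I - Q\<^sub>t + 1 v\<^sup>T = D\<^sup>-\<^sup>1 (S - t a w w\<^sup>T)\<close>. By the Sherman--Morrison
  formula \<open>\<kappa>(Q\<^sub>t) - \<kappa>(P) = t a K / (1 - t a r)\<close> with \<open>r = w\<^sup>T S\<^sup>-\<^sup>1 w\<close> and
  \<open>K = w\<^sup>T S\<^sup>-\<^sup>1 D S\<^sup>-\<^sup>1 w\<close>. Hence \<open>\<mu> = a K\<close>, while \<open>t = 1\<close> gives \<open>c = a K / (1 - a r)\<close>. The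
  denominator is nonzero because \<open>S - a w w\<^sup>T\<close> is the matrix \<open>S\<close> of the connected graph in which
  the edge is replaced by loops, so that it is invertible.
\<close>

text \<open>This keeps the all-ones vector in the form \<open>vec 1\<close> used by the
  definitions.\<close>

declare vec_1 [simp del]

section \<open>Matrices\<close>

lemma matrix_inv_mult:
  fixes A :: "real ^ 'n ^ 'n"
  assumes "invertible A"
  shows "A ** matrix_inv A = mat 1" and "matrix_inv A ** A = mat 1"
  using someI_ex[OF assms[unfolded invertible_def]] by (auto simp: matrix_inv_def)

text \<open>For square matrices a right inverse is two-sided, so checking one product identifies the
  inverse.\<close>

lemma matrix_inv_eqI:
  fixes A B :: "real ^ 'n ^ 'n"
  assumes "A ** B = mat 1"
  shows "invertible A" and "matrix_inv A = B"
proof -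
  show inv: "invertible A"
    using assms invertible_right_inverse by blast
  have "matrix_inv A = matrix_inv A ** (A ** B)"
    by (simp add: assms)
  also have "\<dots> = B"
    by (simp add: matrix_mul_assoc matrix_inv_mult[OF inv])
  finally show "matrix_inv A = B" .
qed

lemma outer_mult_vec: "outer u v *v x = (v \<bullet> x) *\<^sub>R u"
  by (simp add: vec_eq_iff outer_def matrix_vector_mult_def inner_vec_def sum_distrib_right
      sum_distrib_left mult_ac)

lemma mult_outer: "M ** outer u v = outer (M *v u) v"
  by (simp add: vec_eq_iff outer_def matrix_vector_mult_def matrix_matrix_mult_def
      sum_distrib_left mult_ac)

lemma matrix_add_rdistrib: "(A + B) ** C = A ** C + B ** C"
  by (simp add: vec_eq_iff matrix_matrix_mult_def sum.distrib distrib_right)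

lemma mult_scaleR_matrix:
  fixes M :: "real ^ 'm ^ 'n"
  shows "M ** (c *\<^sub>R N) = c *\<^sub>R (M ** N)"
  by (simp add: matrix_scalar_ac scalar_matrix_assoc)

lemma trace_outer: "trace (outer u v) = u \<bullet> v"
  by (simp add: trace_def outer_def inner_vec_def)

lemma outer_scaleR: "outer u (c *\<^sub>R v) = c *\<^sub>R outer u v"
  by (simp add: vec_eq_iff outer_def)

lemma outer_diff: "outer u (v - v') = outer u v - outer u v'"
  by (simp add: vec_eq_iff outer_def algebra_simps)

lemma trace_scaleR: "trace (c *\<^sub>R M) = c * trace (M :: real ^ 'n ^ 'n)"
  by (simp add: trace_def sum_distrib_left)

lemma sherman_morrison:
  fixes S :: "real ^ 'n ^ 'n" and u v :: "real ^ 'n" and c :: real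
  defines "r \<equiv> v \<bullet> (matrix_inv S *v u)"
  assumes S: "invertible S" and r: "1 - c * r \<noteq> 0"
  shows "invertible (S - c *\<^sub>R outer u v)"
    and "matrix_inv (S - c *\<^sub>R outer u v) = matrix_inv S
      + (c / (1 - c * r)) *\<^sub>R outer (matrix_inv S *v u) (v v* matrix_inv S)"
proof -
  let ?R = "matrix_inv S"
  define k where "k = c / (1 - c * r)"
  define B where "B = ?R + k *\<^sub>R outer (?R *v u) (v v* ?R)"
  have SR: "S *v (?R *v x) = x" for x
    by (simp add: matrix_vector_mul_assoc matrix_inv_mult[OF S])
  \<comment> \<open>The scalar equation that makes all multiples of \<open>u\<close> cancel in the
    product below.\<close>
  have k: "k - c - c * r * k = 0"
    using r by (simp add: k_def field_simps)
  have "((S - c *\<^sub>R outer u v) ** B) *v x = mat 1 *v x" for x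
  proof -
    let ?\<alpha> = "v \<bullet> (?R *v x)"
    have B: "B *v x = ?R *v x + (k * ?\<alpha>) *\<^sub>R (?R *v u)"
      by (simp add: B_def matrix_vector_mult_add_rdistrib scaleR_matrix_vector_assoc[symmetric]
          outer_mult_vec dot_lmul_matrix)
    have "((S - c *\<^sub>R outer u v) ** B) *v x
        = x + (k * ?\<alpha>) *\<^sub>R u - (c * (?\<alpha> + k * ?\<alpha> * r)) *\<^sub>R u"
      by (simp add: matrix_vector_mul_assoc[symmetric] B matrix_vector_mult_diff_rdistrib
          scaleR_matrix_vector_assoc[symmetric] outer_mult_vec matrix_vector_right_distrib
          matrix_vector_mult_scaleR SR inner_add_right r_def algebra_simps)
    also have "\<dots> = x + (?\<alpha> * (k - c - c * r * k)) *\<^sub>R u"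
      by (simp add: algebra_simps)
    finally show ?thesis
      using k by simp
  qed
  then have *: "(S - c *\<^sub>R outer u v) ** B = mat 1"
    using matrix_eq by blast
  show "invertible (S - c *\<^sub>R outer u v)"
    and "matrix_inv (S - c *\<^sub>R outer u v)
      = ?R + (c / (1 - c * r)) *\<^sub>R outer (?R *v u) (v v* ?R)"
    using matrix_inv_eqI[OF *] by (simp_all add: B_def k_def)
qed

section \<open>Kemeny's constant\<close>

text \<open>Passing from \<open>v\<close> to \<open>v'\<close> is a rank-one update by
  \<open>v' - v\<close>, which is orthogonal to \<open>vec 1\<close>. The inverse fixes
  \<open>vec 1\<close>, so the Sherman-Morrison denominator is 1 and the correction has trace
  0.\<close>

lemma kemeny_value_unique:
  fixes Q :: "real ^ 'n ^ 'n"
  assumes Q: "Q *v vec 1 = vec 1"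
    and v: "v \<bullet> vec 1 = 1" "invertible (mat 1 - Q + outer (vec 1) v)"
    and v': "v' \<bullet> vec 1 = 1"
  shows "trace (matrix_inv (mat 1 - Q + outer (vec 1) v'))
    = trace (matrix_inv (mat 1 - Q + outer (vec 1) v))"
proof -
  let ?M = "mat 1 - Q + outer (vec 1) v" and ?u = "v' - v"
  let ?R = "matrix_inv ?M"
  have "?M *v vec 1 = vec 1"
    by (simp add: matrix_vector_mult_diff_rdistrib matrix_vector_mult_add_rdistrib
        outer_mult_vec Q v)
  then have R1: "?R *v vec 1 = vec 1"
    by (metis matrix_vector_mul_assoc matrix_inv_mult(2)[OF v(2)] matrix_vector_mul_lid)
  have u1: "?u \<bullet> vec 1 = 0"
    by (simp add: inner_diff_left v v')
  have M': "mat 1 - Q + outer (vec 1) v' = ?M - (-1) *\<^sub>R outer (vec 1) ?u"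
    by (simp add: outer_diff)
  have "matrix_inv (mat 1 - Q + outer (vec 1) v') = ?R - outer (vec 1) (?u v* ?R)"
    unfolding M' using sherman_morrison(2)[OF v(2), of "-1" ?u "vec 1"] by (simp add: R1 u1)
  moreover have "trace (outer (vec 1) (?u v* ?R)) = 0"
    by (simp add: trace_outer inner_commute[of "vec 1"] dot_lmul_matrix R1 u1)
  ultimately show ?thesis
    by (simp add: trace_sub)
qed

lemma has_kemeny_unique:
  assumes "has_kemeny Q k" "has_kemeny Q k'"
  shows "k' = k"
  using assms kemeny_value_unique unfolding has_kemeny_def by metis

lemma has_kemeny_imp:
  assumes "has_kemeny Q k"
  shows "kemeny_defined Q" and "kemeny Q = k"
  using assms has_kemeny_unique unfolding kemeny_defined_def kemeny_def by blast+

section \<open>Weighted graphs\<close>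

lemma transpose_eq_nth:
  assumes "transpose A = A"
  shows "A $ j $ i = A $ i $ j"
  using arg_cong[OF assms, of "\<lambda>M. M $ i $ j"] by (simp add: transpose_def)

lemma degree_vec_nth: "degree_vec A $ i = (\<Sum>j\<in>UNIV. A $ i $ j)"
  by (simp add: degree_vec_def matrix_vector_mult_def)

text \<open>A second vertex exists, and the first step of a walk to it has positive weight in row
  \<open>i\<close>.\<close>

lemma degree_vec_pos:
  fixes A :: "real ^ 'n ^ 'n"
  assumes "CARD('n) \<ge> 2" "weighted_graph A" "graph_connected A"
  shows "degree_vec A $ i > 0"
proof -
  have "\<exists>j. j \<noteq> i"
  proof (rule ccontr)
    assume "\<not> ?thesis"
    then have "(UNIV :: 'n set) = {i}"
      by auto
    with assms(1) show False
      by (metis card_1_singleton_iff One_nat_def not_less_eq_eq numeral_2_eq_2 order_refl)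
  qed
  then obtain j where "j \<noteq> i" ..
  moreover have "(\<lambda>k l. A $ k $ l \<noteq> 0)\<^sup>*\<^sup>* i j"
    using assms(3) by (simp add: graph_connected_def)
  ultimately obtain k where "A $ i $ k \<noteq> 0"
    by (auto elim: converse_rtranclpE)
  moreover have nonneg: "0 \<le> A $ i $ j" for j
    using assms(2) by (simp add: weighted_graph_def)
  ultimately have "A $ i $ k > 0"
    by (simp add: order_less_le)
  then show ?thesis
    unfolding degree_vec_nth by (intro sum_pos2[of _ k]) (auto simp: nonneg)
qed

lemma diag_mat_mult_vec: "diag_mat d *v x = (\<chi> i. d $ i * x $ i)"
  by (simp add: vec_eq_iff diag_mat_def matrix_vector_mult_def if_distrib if_distribR
      cong: if_cong)

lemma degree_mat_ones: "degree_mat A *v vec 1 = degree_vec A"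
  by (simp add: degree_mat_def diag_mat_mult_vec vec_eq_iff)

lemma invertible_iff_ker:
  fixes M :: "real ^ 'n ^ 'n"
  shows "invertible M \<longleftrightarrow> (\<forall>x. M *v x = 0 \<longrightarrow> x = 0)"
  by (simp add: invertible_left_inverse matrix_left_invertible_ker)

lemma invertible_degree_mat:
  assumes "\<And>i. degree_vec A $ i > 0"
  shows "invertible (degree_mat A)"
proof -
  have "degree_vec A $ i \<noteq> 0" for i
    using assms[of i] by simp
  then show ?thesis
    unfolding invertible_iff_ker degree_mat_def diag_mat_mult_vec by (simp add: vec_eq_iff)
qed

lemma l1_norm_degree_vec_pos:
  assumes "\<And>i. degree_vec A $ i > 0"
  shows "l1_norm (degree_vec A) > 0"
  unfolding l1_norm_def by (rule sum_pos) (use assms in \<open>auto simp: less_imp_neq[THEN not_sym]\<close>)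

lemma degree_vec_dot_ones:
  assumes "\<And>i. degree_vec A $ i > 0"
  shows "degree_vec A \<bullet> vec 1 = l1_norm (degree_vec A)"
  using assms by (simp add: l1_norm_def inner_vec_def abs_of_pos)

text \<open>Expanding the square gives two pure square sums, equal by symmetry; each is the
  quadratic form of the degree matrix, hence the factor 1/2.\<close>

lemma laplacian_quadratic_form:
  assumes "transpose A = A"
  shows "x \<bullet> ((degree_mat A - A) *v x) = (\<Sum>i\<in>UNIV. \<Sum>j\<in>UNIV. A $ i $ j * (x $ i - x $ j)\<^sup>2) / 2"
proof -
  have sym: "A $ j $ i = A $ i $ j" for i j
    by (rule transpose_eq_nth[OF assms])
  have "(\<Sum>i\<in>UNIV. \<Sum>j\<in>UNIV. A $ i $ j * (x $ j)\<^sup>2) = (\<Sum>i\<in>UNIV. \<Sum>j\<in>UNIV. A $ i $ j * (x $ i)\<^sup>2)"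
    by (subst sum.swap) (simp add: sym)
  moreover have "x \<bullet> (degree_mat A *v x) = (\<Sum>i\<in>UNIV. \<Sum>j\<in>UNIV. A $ i $ j * (x $ i)\<^sup>2)"
    by (simp add: degree_mat_def diag_mat_mult_vec inner_vec_def degree_vec_nth
        sum_distrib_left sum_distrib_right power2_eq_square mult_ac)
  moreover have "x \<bullet> (A *v x) = (\<Sum>i\<in>UNIV. \<Sum>j\<in>UNIV. A $ i $ j * (x $ i * x $ j))"
    by (simp add: inner_vec_def matrix_vector_mult_def sum_distrib_left mult_ac)
  moreover have "(\<Sum>i\<in>UNIV. \<Sum>j\<in>UNIV. A $ i $ j * (x $ i - x $ j)\<^sup>2)
      = (\<Sum>i\<in>UNIV. \<Sum>j\<in>UNIV. A $ i $ j * (x $ i)\<^sup>2) + (\<Sum>i\<in>UNIV. \<Sum>j\<in>UNIV. A $ i $ j * (x $ j)\<^sup>2)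
        - 2 * (\<Sum>i\<in>UNIV. \<Sum>j\<in>UNIV. A $ i $ j * (x $ i * x $ j))"
    by (simp add: sum.distrib[symmetric] sum_subtractf[symmetric] sum_distrib_left
        power2_eq_square algebra_simps)
  ultimately show ?thesis
    by (simp add: matrix_vector_mult_diff_rdistrib inner_diff_right)
qed

text \<open>The quadratic form of \<open>S_mat A\<close> is the Laplacian form plus a multiple of
  the square of \<open>?d \<bullet> x\<close>, both nonnegative. On the kernel the first makes
  \<open>x\<close> constant by connectedness, and the second makes that constant zero.\<close>

lemma invertible_S_mat:
  assumes A: "weighted_graph A" and conn: "graph_connected A"
    and pos: "\<And>i. degree_vec A $ i > 0"
  shows "invertible (S_mat A)"
  unfolding invertible_iff_ker
proof (intro allI impI)
  fix x assume x: "S_mat A *v x = 0"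
  let ?d = "degree_vec A" and ?q = "\<lambda>i j. A $ i $ j * (x $ i - x $ j)\<^sup>2"
  note l = l1_norm_degree_vec_pos[OF pos]
  have q: "?q i j \<ge> 0" for i j
    using A by (simp add: weighted_graph_def)
  have Q: "(\<Sum>i\<in>UNIV. \<Sum>j\<in>UNIV. ?q i j) \<ge> 0"
    by (intro sum_nonneg q)
  have "x \<bullet> (S_mat A *v x) = (\<Sum>i\<in>UNIV. \<Sum>j\<in>UNIV. ?q i j) / 2 + (?d \<bullet> x)\<^sup>2 / l1_norm ?d"
    using laplacian_quadratic_form[of A x] A
    by (simp add: S_mat_def matrix_vector_mult_add_rdistrib inner_add_right
        weighted_graph_def scaleR_matrix_vector_assoc[symmetric]
        outer_mult_vec inner_commute[of x "degree_vec A"] power2_eq_square)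
  with x have sum0: "(\<Sum>i\<in>UNIV. \<Sum>j\<in>UNIV. ?q i j) / 2 + (?d \<bullet> x)\<^sup>2 / l1_norm ?d = 0"
    by simp
  have "(?d \<bullet> x)\<^sup>2 / l1_norm ?d \<ge> 0"
    using l by simp
  with sum0 Q have Q0: "(\<Sum>i\<in>UNIV. \<Sum>j\<in>UNIV. ?q i j) = 0" and d0: "(?d \<bullet> x)\<^sup>2 / l1_norm ?d = 0"
    by linarith+
  from Q0 have "?q i j = 0" for i j
    by (simp add: sum_nonneg_eq_0_iff sum_nonneg q)
  then have "A $ i $ j = 0 \<or> x $ i = x $ j" for i j
    by simp
  then have step: "x $ i = x $ j" if "A $ i $ j \<noteq> 0" for i j
    using that by blast
  have const: "x $ i = x $ j" for i j
  proof -
    have "(\<lambda>k l. A $ k $ l \<noteq> 0)\<^sup>*\<^sup>* i j"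
      using conn by (simp add: graph_connected_def)
    then show ?thesis
      by induction (auto dest: step)
  qed
  \<comment> \<open>Here \<open>undefined\<close> is just some vertex; \<open>x\<close> has the same
    value everywhere.\<close>
  define c where "c = x $ undefined"
  have xc: "x = c *\<^sub>R vec 1"
    using const by (simp add: vec_eq_iff c_def)
  have "?d \<bullet> x = c * l1_norm ?d"
    by (simp add: xc degree_vec_dot_ones[OF pos])
  with d0 l have "c = 0"
    by simp
  then show "x = 0"
    by (simp add: xc)
qed

section \<open>Perturbation along an edge\<close>

lemma edge_vec_dot_ones: "edge_vec p q \<bullet> vec 1 = 0"
  by (simp add: edge_vec_def inner_diff_left inner_axis')

text \<open>The choice of \<open>v\<close> as the normalised degree vector turns the matrix to be
  inverted into the inverse degree matrix times \<open>S_mat A - c *\<^sub>R W\<close>. A general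
  \<open>c\<close> covers the removal and the derivative alike.\<close>

lemma has_kemeny_edge_perturbation:
  fixes A :: "real ^ 'n ^ 'n" and p q :: 'n
  defines "W \<equiv> outer (edge_vec p q) (edge_vec p q)"
  assumes pos: "\<And>i. degree_vec A $ i > 0"
    and inv: "invertible (S_mat A - c *\<^sub>R W)"
  shows "has_kemeny (matrix_inv (degree_mat A) ** (A + c *\<^sub>R W))
    (trace (matrix_inv (S_mat A - c *\<^sub>R W) ** degree_mat A) - 1)"
proof -
  let ?D = "degree_mat A" and ?d = "degree_vec A" and ?T = "S_mat A - c *\<^sub>R W"
  let ?Q = "matrix_inv ?D ** (A + c *\<^sub>R W)" and ?v = "(1 / l1_norm ?d) *\<^sub>R ?d"
  let ?M = "mat 1 - ?Q + outer (vec 1) ?v"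
  note D = matrix_inv_mult[OF invertible_degree_mat[OF pos]]
  note l = l1_norm_degree_vec_pos[OF pos]
  have "(A + c *\<^sub>R W) *v vec 1 = ?D *v vec 1"
    by (simp add: matrix_vector_mult_add_rdistrib scaleR_matrix_vector_assoc[symmetric] W_def
        outer_mult_vec edge_vec_dot_ones degree_mat_ones degree_vec_def)
  then have Q1: "?Q *v vec 1 = vec 1"
    by (simp add: matrix_vector_mul_assoc[symmetric]) (simp add: matrix_vector_mul_assoc D)
  have v1: "?v \<bullet> vec 1 = 1"
    using l by (simp add: degree_vec_dot_ones[OF pos])
  have "?D ** (matrix_inv ?D ** ?T) = ?T"
    by (simp add: matrix_mul_assoc D)
  have "matrix_inv ?D *v ?d = vec 1"
    by (simp add: degree_mat_ones[symmetric] matrix_vector_mul_assoc D)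
  \<comment> \<open>Subtraction is written as scaling by -1 so that distributivity over sums and
    scalars is enough.\<close>
  moreover have "?T = (?D + (-1) *\<^sub>R (A + c *\<^sub>R W)) + (1 / l1_norm ?d) *\<^sub>R outer ?d ?d"
    by (simp add: S_mat_def)
  ultimately have M: "?M = matrix_inv ?D ** ?T"
    by (simp only: matrix_add_ldistrib mult_scaleR_matrix D
        mult_outer outer_scaleR) (simp add: algebra_simps)
  have "?M ** (matrix_inv ?T ** ?D) = matrix_inv ?D ** (?T ** matrix_inv ?T) ** ?D"
    unfolding M by (simp only: matrix_mul_assoc)
  also have "\<dots> = mat 1"
    by (simp add: matrix_inv_mult[OF inv] D)
  finally have "?M ** (matrix_inv ?T ** ?D) = mat 1" .
  from matrix_inv_eqI[OF this] show ?thesis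
    unfolding has_kemeny_def using Q1 v1 by metis
qed

text \<open>Adding \<open>a w w\<^sup>T\<close> to the adjacency matrix replaces the edge by loops at its ends.\<close>

context
  fixes A :: "real ^ 'n ^ 'n" and p q :: 'n
begin

text \<open>The outer product has entries -1 at the two positions of the edge, cancelling its
  weight, and 1 on the diagonal at \<open>p\<close> and \<open>q\<close>.\<close>

lemma loop_graph_nth:
  assumes "transpose A = A" "p \<noteq> q"
  shows "(A + (A $ p $ q) *\<^sub>R outer (edge_vec p q) (edge_vec p q)) $ i $ j
    = remove_edge p q A $ i $ j + (if i = j \<and> i \<in> {p, q} then A $ p $ q else 0)"
proof -
  have "A $ q $ p = A $ p $ q"
    by (rule transpose_eq_nth[OF assms(1)])
  then show ?thesis
    using assms(2)
    by (auto simp: outer_def edge_vec_def axis_def remove_edge_def doubleton_eq_iff)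
qed

lemma weighted_graph_loop_graph:
  assumes "weighted_graph A" "p \<noteq> q"
  shows "weighted_graph (A + (A $ p $ q) *\<^sub>R outer (edge_vec p q) (edge_vec p q))"
proof -
  have sym: "transpose A = A" and nonneg: "A $ i $ j \<ge> 0" for i j
    using assms(1) by (auto simp: weighted_graph_def)
  have "A $ i $ j = A $ j $ i" for i j
    by (rule transpose_eq_nth[OF sym])
  then have "(A + (A $ p $ q) *\<^sub>R outer (edge_vec p q) (edge_vec p q)) $ i $ j
      = (A + (A $ p $ q) *\<^sub>R outer (edge_vec p q) (edge_vec p q)) $ j $ i" for i j
    by (simp add: outer_def)
  moreover have "(A + (A $ p $ q) *\<^sub>R outer (edge_vec p q) (edge_vec p q)) $ i $ j \<ge> 0" for i j
    unfolding loop_graph_nth[OF sym assms(2)] by (auto simp: remove_edge_def nonneg)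
  ultimately show ?thesis
    unfolding weighted_graph_def by (auto simp: transpose_def vec_eq_iff)
qed

lemma graph_connected_loop_graph:
  assumes A: "weighted_graph A" and "p \<noteq> q" and conn: "graph_connected (remove_edge p q A)"
  shows "graph_connected (A + (A $ p $ q) *\<^sub>R outer (edge_vec p q) (edge_vec p q))"
  unfolding graph_connected_def
proof (intro allI)
  fix i j
  have "transpose A = A"
    using A by (simp add: weighted_graph_def)
  note nth = loop_graph_nth[OF this \<open>p \<noteq> q\<close>]
  \<comment> \<open>With nonnegative weights, added loops cannot cancel a remaining entry.\<close>
  have "remove_edge p q A $ k $ l \<ge> 0" "A $ p $ q \<ge> 0" for k l
    using A by (auto simp: remove_edge_def weighted_graph_def)
  then have "(A + (A $ p $ q) *\<^sub>R outer (edge_vec p q) (edge_vec p q)) $ k $ l \<noteq> 0"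
    if "remove_edge p q A $ k $ l \<noteq> 0" for k l
    using that unfolding nth by (smt (verit))
  moreover have "(\<lambda>k l. remove_edge p q A $ k $ l \<noteq> 0)\<^sup>*\<^sup>* i j"
    using conn by (simp add: graph_connected_def)
  ultimately show
    "(\<lambda>k l. (A + (A $ p $ q) *\<^sub>R outer (edge_vec p q) (edge_vec p q)) $ k $ l \<noteq> 0)\<^sup>*\<^sup>* i j"
    by (rule rtranclp_mono[THEN predicate2D, OF predicate2I])
qed

end

lemma degree_vec_add_edge_outer:
  "degree_vec (A + c *\<^sub>R outer (edge_vec p q) (edge_vec p q)) = degree_vec A"
  by (simp add: degree_vec_def matrix_vector_mult_add_rdistrib
      scaleR_matrix_vector_assoc[symmetric] outer_mult_vec edge_vec_dot_ones)

text \<open>Degrees are unchanged, so only the term \<open>- A\<close> moves. Thus the updated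
  matrix is itself the \<open>S_mat\<close> of a graph.\<close>

lemma S_mat_add_edge_outer:
  "S_mat (A + c *\<^sub>R outer (edge_vec p q) (edge_vec p q))
    = S_mat A - c *\<^sub>R outer (edge_vec p q) (edge_vec p q)"
  by (simp add: S_mat_def degree_mat_def degree_vec_add_edge_outer)

text \<open>If the denominator vanished, the inverse of \<open>S_mat A\<close> applied to the edge
  vector would lie in the kernel of the update, forcing the edge vector to be zero.\<close>

lemma edge_denominator_nonzero:
  assumes "invertible (S_mat A)" and "p \<noteq> q"
    and "invertible (S_mat A - c *\<^sub>R outer (edge_vec p q) (edge_vec p q))"
  shows "1 - c * (edge_vec p q \<bullet> (matrix_inv (S_mat A) *v edge_vec p q)) \<noteq> 0"
proof
  let ?w = "edge_vec p q" and ?S = "S_mat A"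
  let ?x = "matrix_inv ?S *v ?w"
  assume 0: "1 - c * (?w \<bullet> ?x) = 0"
  have Sx: "?S *v ?x = ?w"
    by (simp add: matrix_vector_mul_assoc matrix_inv_mult[OF assms(1)])
  have "(?S - c *\<^sub>R outer ?w ?w) *v ?x = (1 - c * (?w \<bullet> ?x)) *\<^sub>R ?w"
    by (simp add: matrix_vector_mult_diff_rdistrib Sx scaleR_matrix_vector_assoc[symmetric]
        outer_mult_vec algebra_simps)
  with 0 have "?x = 0"
    using assms(3) by (simp add: invertible_iff_ker)
  with Sx have "?w $ p = 0"
    by simp
  with \<open>p \<noteq> q\<close> show False
    by (simp add: edge_vec_def axis_def)
qed

text \<open>As \<open>matrix_inv\<close>, \<open>THE\<close> and \<open>Lim\<close> are total, the
  conclusion also asserts that the inverses, Kemeny constants and limit exist and that the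
  denominator is nonzero.\<close>

theorem theorem2:
  fixes A :: "real ^ 'n ^ 'n" and p q :: 'n
  assumes "CARD('n) \<ge> 2"
    and "weighted_graph A"
    and "graph_connected A"
    and "p \<noteq> q"
    and "A $ p $ q \<noteq> 0"
    and "\<not> cut_edge A p q"
  shows "invertible (degree_mat A) \<and> invertible (S_mat A)
    \<and> kemeny_defined (transition_mat A)
    \<and> kemeny_defined (removed_transition_mat A p q)
    \<and> (\<forall>\<^sub>F t in at_right 0. kemeny_defined (perturbed_mat A p q t))
    \<and> (kemeny_quotient A p q \<longlongrightarrow> derivative_centrality A p q) (at_right 0)
    \<and> 1 - A $ p $ q * (edge_vec p q \<bullet> (matrix_inv (S_mat A) *v edge_vec p q)) \<noteq> 0
    \<and> kemeny_centrality A p q = derivative_centrality A p q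
        / (1 - A $ p $ q * (edge_vec p q \<bullet> (matrix_inv (S_mat A) *v edge_vec p q)))"
proof -
  note pos = degree_vec_pos[OF assms(1-3)]
  let ?w = "edge_vec p q" and ?R = "matrix_inv (S_mat A)" and ?a = "A $ p $ q"
  let ?D = "degree_mat A"
  define r where "r = ?w \<bullet> (?R *v ?w)"
  \<comment> \<open>The scalar \<open>K\<close> of the outline, in the trace form produced by the
    rank-one correction.\<close>
  define K where "K = trace (outer (?R *v ?w) (?w v* ?R) ** ?D)"
  have S: "invertible (S_mat A)"
    by (rule invertible_S_mat[OF assms(2,3) pos])
  have "graph_connected (remove_edge p q A)"
    using assms(5,6) by (simp add: cut_edge_def)
  then have "invertible (S_mat A - ?a *\<^sub>R outer ?w ?w)"
    unfolding S_mat_add_edge_outer[symmetric] using assms pos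
    by (intro invertible_S_mat weighted_graph_loop_graph graph_connected_loop_graph)
      (auto simp: degree_vec_add_edge_outer)
  from edge_denominator_nonzero[OF S assms(4) this] have r1: "1 - ?a * r \<noteq> 0"
    by (simp add: r_def)

  have perturbed: "perturbed_mat A p q t = matrix_inv ?D ** (A + (t * ?a) *\<^sub>R outer ?w ?w)" for t
    by (simp add: perturbed_mat_def transition_mat_def matrix_add_ldistrib
        mult_scaleR_matrix)
  \<comment> \<open>Removal and the original chain are the cases \<open>t = 1\<close> and
    \<open>t = 0\<close> of one family.\<close>
  have removed: "removed_transition_mat A p q = perturbed_mat A p q 1"
    unfolding perturbed by (simp add: removed_transition_mat_def)
  have transition: "transition_mat A = perturbed_mat A p q 0"
    by (simp add: perturbed_mat_def)

  have has: "has_kemeny (perturbed_mat A p q t)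
      (trace (?R ** ?D) + t * ?a * K / (1 - t * ?a * r) - 1)" if "1 - t * ?a * r \<noteq> 0" for t
  proof -
    have "1 - t * ?a * (?w \<bullet> (?R *v ?w)) \<noteq> 0"
      using that by (simp add: r_def)
    note sm = sherman_morrison[OF S this]
    have "trace (matrix_inv (S_mat A - (t * ?a) *\<^sub>R outer ?w ?w) ** ?D)
        = trace (?R ** ?D) + t * ?a * K / (1 - t * ?a * r)"
      by (simp add: sm(2) r_def K_def matrix_add_rdistrib trace_add scalar_matrix_assoc[symmetric]
          trace_scaleR)
    with has_kemeny_edge_perturbation[OF pos sm(1)] show ?thesis
      by (simp add: perturbed)
  qed
  note kemeny = has_kemeny_imp[OF has]
  have kemeny0: "kemeny (transition_mat A) = trace (?R ** ?D) - 1"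
    unfolding transition using kemeny(2)[of 0] by simp
  have centrality: "kemeny_centrality A p q = ?a * K / (1 - ?a * r)"
    unfolding kemeny_centrality_def kemeny0 removed using kemeny(2)[of 1] r1 by simp

  have lim: "((\<lambda>t. 1 - t * ?a * r) \<longlongrightarrow> 1) (at_right 0)"
    by (rule tendsto_eq_intros refl | simp)+
  \<comment> \<open>The closed formula \<open>has\<close> therefore applies for all small positive
    \<open>t\<close>.\<close>
  have ev: "\<forall>\<^sub>F t in at_right 0. 1 - t * ?a * r \<noteq> 0"
    using tendsto_imp_eventually_ne[OF lim, of 0] by simp
  have "((\<lambda>t. ?a * K / (1 - t * ?a * r)) \<longlongrightarrow> ?a * K / 1) (at_right 0)"
    by (intro tendsto_divide tendsto_const lim) simp
  moreover have "\<forall>\<^sub>F t in at_right 0. ?a * K / (1 - t * ?a * r) = kemeny_quotient A p q t"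
    \<comment> \<open>Positivity of \<open>t\<close> allows its cancellation in the
      quotient.\<close>
    using ev eventually_at_right_less[of 0]
  proof eventually_elim
    case (elim t)
    then show ?case
      using kemeny(2)[of t] by (simp add: kemeny_quotient_def kemeny0)
  qed
  ultimately have quotient: "(kemeny_quotient A p q \<longlongrightarrow> ?a * K) (at_right 0)"
    using tendsto_cong by force
  then have derivative: "derivative_centrality A p q = ?a * K"
    unfolding derivative_centrality_def by (intro tendsto_Lim) auto

  have "\<forall>\<^sub>F t in at_right 0. kemeny_defined (perturbed_mat A p q t)"
    using ev by eventually_elim (rule kemeny(1))
  moreover have "kemeny_defined (transition_mat A)" "kemeny_defined (removed_transition_mat A p q)"
    unfolding transition removed using kemeny(1)[of 0] kemeny(1)[of 1] r1 by auto
  ultimately show ?thesis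
    using S invertible_degree_mat[OF pos] quotient r1 centrality derivative
    by (simp add: r_def)
qed

end
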